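(* For every integer $n\ge 1$ and every complex number $x$ with $|x|<1$, $$\left(\frac{\arctan(x)}{x}\right)^n=\frac{\Gamma(n+1)}{2^n}\sum_{m=0}^{\infty}\frac{(-x^2)^m}{m+\frac n2}\,t_m(n-1),$$ where at $x=0$ the left-hand side is understood as its limiting value $1$.
   Context: The coefficients $t_k(n)$, for integers $k\ge 0$ and $n\ge 0$, are defined recursively by $t_k(0)=1$ and, for $n\ge 1$, $t_k(n)=\sum_{m=0}^{k}\frac{1}{m+\frac n2}\,t_m(n-1)$. Equivalently, for $n\ge 1$, $t_k(n)=\sum_{0\le m_1\le m_2\le\cdots\le m_n\le k}\ \prod_{j=1}^{n}\frac{1}{m_j+\frac j2}$. For $|x|<1$, $\arctan(x)=\frac{1}{2i}\log\frac{1+ix}{1-ix}$ with the principal branch of the logarithm. *)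

theory Defs
  imports "HOL-Analysis.Analysis"
begin

text \<open>The numbers $t_k(n)$; the index $n \ge 1$ of the recursion appears here as \<^term>\<open>Suc n\<close>.\<close>

fun t :: "nat \<Rightarrow> nat \<Rightarrow> real" where
  "t k 0 = 1"
| "t k (Suc n) = (\<Sum>m=0..k. 1 / (real m + real (Suc n) / 2) * t m n)"

text \<open>
  The library function \<^const>\<open>Arctan\<close> is defined as
  \<^term>\<open>(\<i> / 2) * Ln ((1 - \<i> * x) / (1 + \<i> * x))\<close>, which takes the reciprocal argument of the
  logarithm and the opposite sign. On the open unit disc the two conventions agree.
\<close>

lemma Arctan_eq_Ln:
  fixes x :: complex
  assumes "norm x < 1"
  shows "Arctan x = 1 / (2 * \<i>) * Ln ((1 + \<i> * x) / (1 - \<i> * x))"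
proof -
  define w where "w = (1 + \<i> * x) / (1 - \<i> * x)"
  have ne: "1 + \<i> * x \<noteq> 0" "1 - \<i> * x \<noteq> 0"
  proof -
    have "norm (\<i> * x) < 1" using assms by (simp add: norm_mult)
    then show "1 + \<i> * x \<noteq> 0" "1 - \<i> * x \<noteq> 0"
      by (metis add_eq_0_iff norm_minus_cancel norm_one less_irrefl,
          metis eq_iff_diff_eq_0 norm_one less_irrefl)
  qed
  have "w \<notin> \<real>\<^sub>\<le>\<^sub>0"
  proof
    assume "w \<in> \<real>\<^sub>\<le>\<^sub>0"
    then obtain r where r: "w = of_real r" "r \<le> 0" by (auto elim: nonpos_Reals_cases)
    have "1 + \<i> * x = of_real r * (1 - \<i> * x)"
      using ne r by (simp add: w_def field_simps)
    then have "\<i> * x * of_real (1 + r) = of_real (r - 1)"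
      by (simp add: algebra_simps)
    then have "norm (\<i> * x * of_real (1 + r)) = norm (of_real (r - 1) :: complex)"
      by simp
    then have eq: "norm x * \<bar>1 + r\<bar> = \<bar>r - 1\<bar>"
      unfolding norm_mult norm_of_real by simp
    have "norm x * \<bar>1 + r\<bar> \<le> \<bar>1 + r\<bar>"
      using assms by (simp add: mult_left_le_one_le)
    with eq r have "r = 0" by linarith
    with eq assms show False by simp
  qed
  then have "Ln (inverse w) = - Ln w" by (rule Ln_inverse)
  moreover have "inverse w = (1 - \<i> * x) / (1 + \<i> * x)" by (simp add: w_def)
  ultimately show ?thesis by (simp add: Arctan_def flip: w_def)
qed

text \<open>
  The quotient with its removable singularity at $0$ filled in;
  the value there is the limit by the lemma below.
\<close>

definition Arctan_quot :: "complex \<Rightarrow> complex" where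
  "Arctan_quot x = (if x = 0 then 1 else Arctan x / x)"

lemma Arctan_quot_limit: "((\<lambda>x. Arctan x / x) \<longlongrightarrow> Arctan_quot 0) (at 0)"
proof -
  have "(Arctan has_field_derivative inverse (1 + 0\<^sup>2)) (at 0)"
    by (rule has_field_derivative_Arctan) simp
  then show ?thesis by (simp add: has_field_derivative_iff Arctan_quot_def)
qed

end

theory Submission
  imports Defs
begin

text \<open>
  Two generating functions in a variable $z$ carry the argument (for $z = -x^2$ in the end):
  $T_n(z) = \sum_m t_m(n) z^m$ and $P_n(z) = \sum_m \frac{t_m(n)}{m + (n+1)/2} z^m$, the second
  being the series of the theorem with $n + 1$ in place of $n$. Two relations link them.

  \<^item> The recursion makes $t_k(n+1)$ the $k$-th partial sum of the coefficients of $P_n$, and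
    taking partial sums of the coefficients is multiplication by the geometric series. Hence
    $P_n(z) = (1 - z)\, T_{n+1}(z)$ (\<open>t_gf_Suc\<close>).
  \<^item> The weights $m + (n+1)/2$ are removed by differentiation:
    $\frac{d}{dx}\bigl(x^{n+1} P_n(-x^2)\bigr) = 2 x^n\, T_n(-x^2)$
    (\<open>has_field_derivative_weighted_t_gf\<close>).

  The powers of the arctangent satisfy the matching differential equation
  $(\arctan^{n+1})' = (n+1) \arctan^n / (1 + x^2)$, and both $\arctan(x)^{n+1}$ and
  $x^{n+1} P_n(-x^2)$ vanish at $0$.
  So an induction on $n$ gives
  $\arctan(x)^{n+1} = \frac{(n+1)!}{2^{n+1}}\, x^{n+1} P_n(-x^2)$ on the unit disc
  (\<open>Arctan_power_Suc\<close>), starting from $T_0(-x^2) = 1 / (1 + x^2)$.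
  For $x$ other than $0$ one divides by $x^{n+1}$; at $x = 0$ only the coefficient
  $t_0(n) = 2^n / n!$ matters.
\<close>

section \<open>Generating functions and the recursion\<close>

definition t_gf :: "nat \<Rightarrow> complex \<Rightarrow> complex" where
  "t_gf n z = (\<Sum>m. complex_of_real (t m n) * z ^ m)"

definition weighted_t_coeff :: "nat \<Rightarrow> nat \<Rightarrow> complex" where
  "weighted_t_coeff n m = complex_of_real (1 / (real m + real (Suc n) / 2) * t m n)"

definition weighted_t_gf :: "nat \<Rightarrow> complex \<Rightarrow> complex" where
  "weighted_t_gf n z = (\<Sum>m. weighted_t_coeff n m * z ^ m)"

lemma t_Suc_eq_partial_sum:
  "complex_of_real (t k (Suc n)) = (\<Sum>m\<le>k. weighted_t_coeff n m)"
  by (simp add: weighted_t_coeff_def atMost_atLeast0)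

lemma norm_weighted_t_coeff_le: "norm (weighted_t_coeff n m) \<le> 2 * norm (complex_of_real (t m n))"
proof -
  have "1 / (real m + real (Suc n) / 2) \<le> 2"
    by (simp add: field_simps)
  moreover have "0 \<le> 1 / (real m + real (Suc n) / 2)"
    by simp
  ultimately show ?thesis
    unfolding weighted_t_coeff_def norm_of_real abs_mult
    by (intro mult_right_mono) auto
qed

lemma summable_norm_weighted_t_gf:
  assumes "summable (\<lambda>m. norm (complex_of_real (t m n) * z ^ m))"
  shows "summable (\<lambda>m. norm (weighted_t_coeff n m * z ^ m))"
proof (rule summable_comparison_test')
  show "summable (\<lambda>m. 2 * norm (complex_of_real (t m n) * z ^ m))"
    using assms by (rule summable_mult)
next
  fix m
  show "norm (norm (weighted_t_coeff n m * z ^ m)) \<le> 2 * norm (complex_of_real (t m n) * z ^ m)"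
    using mult_right_mono[OF norm_weighted_t_coeff_le[of n m], of "norm (z ^ m)"]
    by (simp add: norm_mult mult.assoc)
qed

text \<open>
  The coefficient of the Cauchy product of a power series with the geometric series is a
  partial sum of coefficients, which is what the recursion for $t$ prescribes.
\<close>

lemma weighted_t_gf_mult_geometric:
  assumes "norm z < 1" and "summable (\<lambda>m. norm (weighted_t_coeff n m * z ^ m))"
  shows "(\<lambda>k. complex_of_real (t k (Suc n)) * z ^ k) sums (weighted_t_gf n z * (1 / (1 - z)))"
proof -
  have geom: "summable (\<lambda>m. norm (z ^ m))"
    using assms(1) by (simp add: norm_power)
  have "(\<Sum>i\<le>k. weighted_t_coeff n i * z ^ i * z ^ (k - i)) =
      complex_of_real (t k (Suc n)) * z ^ k" for k
  proof -
    have "(\<Sum>i\<le>k. weighted_t_coeff n i * z ^ i * z ^ (k - i)) = (\<Sum>i\<le>k. weighted_t_coeff n i * z ^ k)"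
      by (rule sum.cong) (simp_all add: mult.assoc flip: power_add)
    then show ?thesis
      by (simp only: t_Suc_eq_partial_sum sum_distrib_right)
  qed
  then show ?thesis
    using Cauchy_product_sums[OF assms(2) geom] suminf_geometric[OF assms(1)]
    by (simp add: weighted_t_gf_def del: t.simps)
qed

text \<open>
  Absolute convergence on the unit disc is inherited from $n$ to $n + 1$: passing to the weighted
  series divides each coefficient by at least $1/2$, and the partial sums of coefficients come
  from a product with the geometric series.
\<close>

lemma summable_norm_t_gf:
  assumes "norm z < 1"
  shows "summable (\<lambda>m. norm (complex_of_real (t m n) * z ^ m))"
  using assms
proof (induction n arbitrary: z)
  case 0
  then show ?case by (simp add: norm_power)
next
  case (Suc n)
  \<comment> \<open>The Cauchy product yields convergence that need not be absolute. Convergence at a point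
    of larger modulus makes it absolute at $z$.\<close>
  obtain r where r: "norm z < r" "r < 1"
    using Suc.prems dense by blast
  then have "norm (complex_of_real r) < 1" and less: "norm z < norm (complex_of_real r)"
    using norm_ge_zero[of z] by (auto simp del: norm_ge_zero)
  then have "summable (\<lambda>m. complex_of_real (t m (Suc n)) * complex_of_real r ^ m)"
    by (intro sums_summable[OF weighted_t_gf_mult_geometric]
        summable_norm_weighted_t_gf Suc.IH)
  then show ?case
    using less by (rule powser_insidea)
qed

lemma t_gf_sums:
  "norm z < 1 \<Longrightarrow> (\<lambda>m. complex_of_real (t m n) * z ^ m) sums t_gf n z"
  unfolding t_gf_def
  by (intro summable_sums summable_norm_cancel[OF summable_norm_t_gf])

lemma weighted_t_gf_sums:
  "norm z < 1 \<Longrightarrow> (\<lambda>m. weighted_t_coeff n m * z ^ m) sums weighted_t_gf n z"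
  unfolding weighted_t_gf_def
  by (intro summable_sums summable_norm_cancel[OF summable_norm_weighted_t_gf]
      summable_norm_t_gf)

lemma t_gf_Suc: "norm z < 1 \<Longrightarrow> t_gf (Suc n) z = weighted_t_gf n z / (1 - z)"
  using weighted_t_gf_mult_geometric[OF _ summable_norm_weighted_t_gf[OF summable_norm_t_gf]]
    t_gf_sums[of z "Suc n"]
  by (metis sums_unique2 times_divide_eq_right mult_1_right)

lemma t_gf_0: "norm z < 1 \<Longrightarrow> t_gf 0 z = 1 / (1 - z)"
  by (simp add: t_gf_def suminf_geometric)

section \<open>Removing the weights by differentiation\<close>

text \<open>
  The Euler operator $z \frac{d}{dz}$ multiplies the $m$-th coefficient by $m$, so
  $z \frac{d}{dz} + \frac{n+1}{2}$ cancels the weight $1 / (m + \frac{n+1}{2})$.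
\<close>

lemma weighted_t_gf_euler:
  assumes "norm z < 1"
  obtains D where "(weighted_t_gf n has_field_derivative D) (at z)"
    and "2 * (z * D) + of_nat (Suc n) * weighted_t_gf n z = 2 * t_gf n z"
proof -
  define D where "D = (\<Sum>m. diffs (weighted_t_coeff n) m * z ^ m)"
  have deriv: "(weighted_t_gf n has_field_derivative D) (at z)"
    unfolding D_def weighted_t_gf_def[abs_def]
    by (rule termdiffs_strong'[where K = 1])
      (use assms in \<open>auto intro: sums_summable[OF weighted_t_gf_sums]\<close>)
  have "(\<lambda>m. diffs (weighted_t_coeff n) m * z ^ m) sums D"
    by (rule termdiffs_sums_strong[OF weighted_t_gf_sums deriv assms])
  then have "(\<lambda>m. z * (diffs (weighted_t_coeff n) m * z ^ m)) sums (z * D)"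
    by (rule sums_mult)
  then have "(\<lambda>m. of_nat (Suc m) * weighted_t_coeff n (Suc m) * z ^ Suc m) sums (z * D)"
    by (simp add: diffs_def mult_ac)
  then have "(\<lambda>m. of_nat m * weighted_t_coeff n m * z ^ m) sums (z * D)"
    by (subst (asm) sums_Suc_iff) simp
  then have "(\<lambda>m. 2 * (of_nat m * weighted_t_coeff n m * z ^ m)
        + of_nat (Suc n) * (weighted_t_coeff n m * z ^ m))
      sums (2 * (z * D) + of_nat (Suc n) * weighted_t_gf n z)"
    by (intro sums_add sums_mult weighted_t_gf_sums assms)
  moreover have "2 * (of_nat m * weighted_t_coeff n m * z ^ m)
        + of_nat (Suc n) * (weighted_t_coeff n m * z ^ m)
      = 2 * (complex_of_real (t m n) * z ^ m)" for m
  proof -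
    have "(2 * real m + real (Suc n)) * (1 / (real m + real (Suc n) / 2) * t m n) = 2 * t m n"
      by (simp add: field_simps)
    then have "complex_of_real ((2 * real m + real (Suc n))
        * (1 / (real m + real (Suc n) / 2) * t m n)) = complex_of_real (2 * t m n)"
      by (rule arg_cong)
    then have "(2 * of_nat m + of_nat (Suc n)) * weighted_t_coeff n m = 2 * complex_of_real (t m n)"
      unfolding weighted_t_coeff_def
      by (simp only: of_real_mult of_real_add of_real_of_nat_eq of_real_numeral)
    then have "(2 * of_nat m + of_nat (Suc n)) * weighted_t_coeff n m * z ^ m
        = 2 * complex_of_real (t m n) * z ^ m"
      by (rule arg_cong)
    then show ?thesis
      by (simp only: distrib_right mult.assoc)
  qed
  ultimately have "(\<lambda>m. 2 * (complex_of_real (t m n) * z ^ m))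
      sums (2 * (z * D) + of_nat (Suc n) * weighted_t_gf n z)"
    by simp
  moreover have "(\<lambda>m. 2 * (complex_of_real (t m n) * z ^ m)) sums (2 * t_gf n z)"
    by (intro sums_mult t_gf_sums assms)
  ultimately have "2 * (z * D) + of_nat (Suc n) * weighted_t_gf n z = 2 * t_gf n z"
    by (rule sums_unique2)
  with deriv show thesis by (rule that)
qed

lemma has_field_derivative_weighted_t_gf:
  assumes "norm x < 1"
  shows "((\<lambda>x. x ^ Suc n * weighted_t_gf n (- (x\<^sup>2))) has_field_derivative
    2 * x ^ n * t_gf n (- (x\<^sup>2))) (at x)"
proof -
  have "norm (- (x\<^sup>2)) < 1"
    using assms by (simp add: norm_power power_less_one_iff)
  then obtain D where D: "(weighted_t_gf n has_field_derivative D) (at (- (x\<^sup>2)))"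
    and euler: "2 * (- (x\<^sup>2) * D) + of_nat (Suc n) * weighted_t_gf n (- (x\<^sup>2)) = 2 * t_gf n (- (x\<^sup>2))"
    by (rule weighted_t_gf_euler)
  have "((\<lambda>x. - (x\<^sup>2)) has_field_derivative - (2 * x)) (at x)"
    by (auto intro!: derivative_eq_intros)
  from DERIV_chain2[OF D this]
  have comp: "((\<lambda>x. weighted_t_gf n (- (x\<^sup>2))) has_field_derivative D * - (2 * x)) (at x)" .
  have "((\<lambda>x. x ^ Suc n) has_field_derivative of_nat (Suc n) * x ^ n) (at x)"
    using DERIV_power[OF DERIV_ident, of "Suc n"] by simp
  from DERIV_mult[OF this comp] have "((\<lambda>x. x ^ Suc n * weighted_t_gf n (- (x\<^sup>2))) has_field_derivative
      of_nat (Suc n) * x ^ n * weighted_t_gf n (- (x\<^sup>2)) + D * - (2 * x) * x ^ Suc n) (at x)" .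
  also have "of_nat (Suc n) * x ^ n * weighted_t_gf n (- (x\<^sup>2)) + D * - (2 * x) * x ^ Suc n
      = x ^ n * (2 * (- (x\<^sup>2) * D) + of_nat (Suc n) * weighted_t_gf n (- (x\<^sup>2)))"
    by (simp add: algebra_simps power2_eq_square)
  also have "\<dots> = 2 * x ^ n * t_gf n (- (x\<^sup>2))"
    unfolding euler by (simp only: mult_ac)
  finally show ?thesis .
qed

section \<open>Powers of the arctangent\<close>

lemma has_field_derivative_Arctan_power:
  assumes "norm x < 1"
  shows "((\<lambda>x. Arctan x ^ Suc n) has_field_derivative
    of_nat (Suc n) * Arctan x ^ n / (1 + x\<^sup>2)) (at x)"
proof -
  have "\<bar>Im x\<bar> < 1"
    using assms abs_Im_le_cmod[of x] by linarith
  then have "(Arctan has_field_derivative inverse (1 + x\<^sup>2)) (at x)"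
    by (intro has_field_derivative_Arctan)
  from DERIV_power[OF this, of "Suc n"] show ?thesis
    by (simp add: divide_inverse mult_ac)
qed

text \<open>
  Both sides vanish at $0$, so it is enough to compare derivatives. Up to a constant factor, the
  hypothesis on the $n$-th power says that these agree. It is stated with the
  factor $1 / (1 + x^2)$ so that it also covers $n = 0$, where no weighted series is available.
\<close>

lemma Arctan_power_Suc_step:
  assumes IH: "\<And>x. norm x < 1 \<Longrightarrow>
      Arctan x ^ n / (1 + x\<^sup>2) = fact n / 2 ^ n * (x ^ n * t_gf n (- (x\<^sup>2)))"
    and "norm x < 1"
  shows "Arctan x ^ Suc n = fact (Suc n) / 2 ^ Suc n * (x ^ Suc n * weighted_t_gf n (- (x\<^sup>2)))"
proof -
  define f where "f = (\<lambda>x. Arctan x ^ Suc n -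
    fact (Suc n) / 2 ^ Suc n * (x ^ Suc n * weighted_t_gf n (- (x\<^sup>2))))"
  have "(f has_field_derivative 0) (at y)" if "norm y < 1" for y
  proof -
    have "(f has_field_derivative of_nat (Suc n) * Arctan y ^ n / (1 + y\<^sup>2) -
        fact (Suc n) / 2 ^ Suc n * (2 * y ^ n * t_gf n (- (y\<^sup>2)))) (at y)"
      unfolding f_def using that
      by (intro DERIV_diff DERIV_cmult has_field_derivative_Arctan_power
          has_field_derivative_weighted_t_gf)
    moreover have "of_nat (Suc n) * Arctan y ^ n / (1 + y\<^sup>2) =
        fact (Suc n) / 2 ^ Suc n * (2 * y ^ n * t_gf n (- (y\<^sup>2)))"
      unfolding times_divide_eq_right[symmetric] IH[OF that] by (simp add: field_simps)
    ultimately show ?thesis by simp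
  qed
  then have "\<exists>c. \<forall>y\<in>ball 0 1. f y = c"
    by (intro has_field_derivative_zero_constant convex_ball)
      (auto intro: has_field_derivative_at_within)
  then have "f x = f 0"
    using assms(2) by fastforce
  then show ?thesis
    by (simp add: f_def)
qed

lemma Arctan_power_Suc:
  assumes "norm x < 1"
  shows "Arctan x ^ Suc n = fact (Suc n) / 2 ^ Suc n * (x ^ Suc n * weighted_t_gf n (- (x\<^sup>2)))"
  using assms
proof (induction n arbitrary: x)
  case 0
  show ?case
  proof (rule Arctan_power_Suc_step[OF _ 0])
    fix y :: complex
    assume "norm y < 1"
    then have "norm (- (y\<^sup>2)) < 1"
      by (simp add: norm_power power_less_one_iff)
    from t_gf_0[OF this]
    show "Arctan y ^ 0 / (1 + y\<^sup>2) = fact 0 / 2 ^ 0 * (y ^ 0 * t_gf 0 (- (y\<^sup>2)))"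
      by simp
  qed
next
  case (Suc n)
  show ?case
  proof (rule Arctan_power_Suc_step[OF _ Suc.prems])
    fix y :: complex
    assume y: "norm y < 1"
    then have "norm (- (y\<^sup>2)) < 1"
      by (simp add: norm_power power_less_one_iff)
    from t_gf_Suc[OF this, of n]
    show "Arctan y ^ Suc n / (1 + y\<^sup>2) =
        fact (Suc n) / 2 ^ Suc n * (y ^ Suc n * t_gf (Suc n) (- (y\<^sup>2)))"
      unfolding Suc.IH[OF y] by simp
  qed
qed

section \<open>The value at the origin and the expansion of the quotient\<close>

lemma t_0_eq: "t 0 n = 2 ^ n / fact n"
proof (induction n)
  case (Suc n)
  have "t 0 (Suc n) = 1 / (real (Suc n) / 2) * t 0 n"
    by simp
  also have "\<dots> = 2 ^ Suc n / fact (Suc n)"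
    unfolding Suc.IH by simp
  finally show ?case .
qed simp

lemma weighted_t_gf_at_0: "weighted_t_gf n 0 = 2 ^ Suc n / fact (Suc n)"
proof -
  have "weighted_t_gf n 0 = weighted_t_coeff n 0"
    by (simp add: weighted_t_gf_def)
  also have "\<dots> = complex_of_real (2 ^ Suc n / fact (Suc n))"
    unfolding weighted_t_coeff_def t_0_eq by (rule arg_cong) (simp add: field_simps)
  finally show ?thesis
    by simp
qed

theorem theorem3:
  fixes n :: nat and x :: complex
  assumes "n \<ge> 1" and "norm x < 1"
  shows "summable (\<lambda>m::nat. (- (x\<^sup>2)) ^ m / (of_nat m + of_nat n / 2) * complex_of_real (t m (n - 1)))
    \<and> Arctan_quot x ^ n =
        Gamma (of_nat n + 1) / 2 ^ n *
          (\<Sum>m::nat. (- (x\<^sup>2)) ^ m / (of_nat m + of_nat n / 2) * complex_of_real (t m (n - 1)))"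
proof -
  obtain k where n: "n = Suc k"
    using assms(1) by (cases n) auto
  have terms: "(\<lambda>m. (- (x\<^sup>2)) ^ m / (of_nat m + of_nat n / 2) * complex_of_real (t m (n - 1)))
      = (\<lambda>m. weighted_t_coeff k m * (- (x\<^sup>2)) ^ m)"
    by (simp add: n weighted_t_coeff_def mult.commute)
  have "norm (- (x\<^sup>2)) < 1"
    using assms(2) by (simp add: norm_power power_less_one_iff)
  from weighted_t_gf_sums[OF this, of k]
  have sums: "(\<lambda>m. (- (x\<^sup>2)) ^ m / (of_nat m + of_nat n / 2) * complex_of_real (t m (n - 1)))
      sums weighted_t_gf k (- (x\<^sup>2))"
    unfolding terms .
  have "Gamma (of_nat n + 1) = (fact n :: complex)"
    by (metis Gamma_fact add.commute)
  moreover have "Arctan_quot x ^ n = fact n / 2 ^ n * weighted_t_gf k (- (x\<^sup>2))"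
  proof (cases "x = 0")
    case True
    then show ?thesis
      by (simp add: Arctan_quot_def n weighted_t_gf_at_0 del: fact_Suc)
  next
    case False
    then show ?thesis
      using Arctan_power_Suc[OF assms(2), of k]
      by (simp add: Arctan_quot_def n power_divide del: fact_Suc power_Suc)
  qed
  ultimately show ?thesis
    using sums_summable[OF sums] sums_unique[OF sums] by simp
qed

end
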